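(* Let $m,p$ be positive integers and let $r\in\{0,\ldots,m-1\}$. Write $m=k2^z$ with $k$ odd and $z\ge 0$. Then the state complexity of $m\mathcal{T}+r=\{mt+r\colon t\in\mathcal{T}\}$ with respect to the base $2^p$ is equal to \[ 2k+\left\lceil \frac zp\right\rceil . \]
   Context: For an integer $b\ge 2$, let $A_b=\{0,\ldots,b-1\}$. For $w=c_\ell\cdots c_0\in A_b^*$, put $\mathrm{val}_b(w)=\sum_{j=0}^{\ell}c_jb^j$ (most significant digit first; the empty word has value $0$). For $X\subseteq\mathbb{N}$, $\mathrm{val}_b^{-1}(X)=\{w\in A_b^*\colon \mathrm{val}_b(w)\in X\}$ (leading zeroes are allowed). The state complexity of $X$ with respect to the base $b$ is the state complexity of the language $L=\mathrm{val}_b^{-1}(X)$, i.e. the number $\mathrm{Card}\{w^{-1}L\colon w\in A_b^*\}$ of its left quotients $w^{-1}L=\{u\in A_b^*\colon wu\in L\}$; equivalently, the number of states of the (complete) minimal deterministic automaton of $L$. The Thue-Morse set $\mathcal{T}\subseteq\mathbb{N}$ is the set of natural numbers whose base-$2$ expansion contains an even number of digits $1$ (so $0\in\mathcal{T}$). *)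

theory Defs imports Complex_Main begin

definition digits :: "nat \<Rightarrow> nat set" where
  "digits b = {0..<b}"

text \<open>Words are lists with the most significant digit first, so the head of \<open>rev w\<close> has weight 1.\<close>

definition val :: "nat \<Rightarrow> nat list \<Rightarrow> nat" where
  "val b w = (\<Sum>j<length w. rev w ! j * b ^ j)"

definition val_inv :: "nat \<Rightarrow> nat set \<Rightarrow> nat list set" where
  "val_inv b X = {w \<in> lists (digits b). val b w \<in> X}"

definition left_quotient :: "'a set \<Rightarrow> 'a list \<Rightarrow> 'a list set \<Rightarrow> 'a list set" where
  "left_quotient A w L = {u \<in> lists A. w @ u \<in> L}"

text \<open>Since \<^const>\<open>card\<close> is 0 on infinite sets, the value 0 means that there are infinitely many
  left quotients; a positive value asserts in particular that there are finitely many.\<close>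

definition lang_state_complexity :: "'a set \<Rightarrow> 'a list set \<Rightarrow> nat" where
  "lang_state_complexity A L = card {left_quotient A w L | w. w \<in> lists A}"

definition state_complexity :: "nat \<Rightarrow> nat set \<Rightarrow> nat" where
  "state_complexity b X = lang_state_complexity (digits b) (val_inv b X)"

definition thue_morse :: "nat set" where
  "thue_morse = {t. even (card {i. bit t i})}"

end

theory Submission imports Defs begin

text \<open>
  The quotient by a word \<open>w\<close> depends only on \<open>n = val w\<close>; write \<open>b = 2 ^ p\<close>. A word of length \<open>l\<close>
  with \<open>p * l \<ge> z\<close> sees of \<open>n\<close> only the class of \<open>n\<close>, namely \<open>n mod k\<close> together with the Thue-Morse
  parity of \<open>n div k\<close>, and long words separate the \<open>2 * k\<close> classes. For \<open>p * l < z\<close> there is just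
  one candidate word of length \<open>l\<close>, and it is accepted from \<open>n\<close> iff \<open>n\<close> lies in
  \<open>S l = (m / b ^ l) * T + (r div b ^ l)\<close>. Each \<open>S l\<close> is contained in a single class and two
  sets \<open>S l\<close>, \<open>S l'\<close> with \<open>l < l'\<close> are either disjoint or nested, so a state is determined by the
  least \<open>l\<close> with \<open>n \<in> S l\<close>, or by its class if there is none. Every such label occurs, because one
  can avoid one residue class modulo each of \<open>2, 4, 8, \<dots>\<close> simultaneously; there are
  \<open>2 * k\<close> plus \<open>\<lceil>z / p\<rceil>\<close> labels.
\<close>

section \<open>The Thue-Morse set\<close>

lemma finite_bits_nat: "finite {i. bit (n::nat) i}"
proof (rule finite_subset)
  show "{i. bit n i} \<subseteq> {..n}"
  proof
    fix i assume "i \<in> {i. bit n i}"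
    then have "n div 2 ^ i > 0" by (intro odd_pos) (simp add: bit_iff_odd)
    then have "2 ^ i \<le> n" by (simp add: div_greater_zero_iff)
    then show "i \<in> {..n}" using less_exp[of i] by (meson atMost_iff le_trans less_imp_le)
  qed
qed simp

lemma zero_in_thue_morse [simp]: "0 \<in> thue_morse"
proof -
  have "{i. bit (0::nat) i} = {}" by simp
  then show ?thesis unfolding thue_morse_def by (simp only: mem_Collect_eq card.empty even_zero)
qed

lemma double_in_thue_morse: "2 * n \<in> thue_morse \<longleftrightarrow> n \<in> thue_morse"
proof -
  have "{i. bit (2 * n) i} = Suc ` {i. bit n i}"
  proof (rule set_eqI)
    fix i show "i \<in> {i. bit (2 * n) i} \<longleftrightarrow> i \<in> Suc ` {i. bit n i}"
      by (cases i) (auto simp: bit_0 bit_Suc)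
  qed
  then show ?thesis by (simp add: thue_morse_def card_image)
qed

lemma Suc_double_in_thue_morse: "Suc (2 * n) \<in> thue_morse \<longleftrightarrow> n \<notin> thue_morse"
proof -
  have "{i. bit (Suc (2 * n)) i} = insert 0 (Suc ` {i. bit n i})"
  proof (rule set_eqI)
    fix i show "i \<in> {i. bit (Suc (2 * n)) i} \<longleftrightarrow> i \<in> insert 0 (Suc ` {i. bit n i})"
      by (cases i) (auto simp: bit_0 bit_Suc)
  qed
  then show ?thesis by (simp add: thue_morse_def card_image finite_bits_nat)
qed

lemma one_notin_thue_morse [simp]: "Suc 0 \<notin> thue_morse"
  using Suc_double_in_thue_morse[of 0] by simp

text \<open>The binary digits of \<open>q\<close> are written in front of the \<open>e\<close> low
  digits of \<open>x\<close>, so digit sums add without carries.\<close>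

lemma thue_morse_append:
  "x < 2 ^ e \<Longrightarrow> 2 ^ e * q + x \<in> thue_morse \<longleftrightarrow> (q \<in> thue_morse \<longleftrightarrow> x \<in> thue_morse)"
proof (induction e arbitrary: x)
  case (Suc e)
  have IH: "2 ^ e * q + x div 2 \<in> thue_morse \<longleftrightarrow> (q \<in> thue_morse \<longleftrightarrow> x div 2 \<in> thue_morse)"
    using Suc by auto
  show ?case
  proof (cases "even x")
    case True
    then obtain y where y: "x = 2 * y" by blast
    have "2 ^ Suc e * q + x = 2 * (2 ^ e * q + y)" by (simp add: y)
    with IH show ?thesis by (simp only: double_in_thue_morse y) simp
  next
    case False
    then obtain y where y: "x = Suc (2 * y)" by (metis oddE Suc_eq_plus1)
    have "2 ^ Suc e * q + x = Suc (2 * (2 ^ e * q + y))" by (simp add: y)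
    with IH show ?thesis by (simp only: Suc_double_in_thue_morse y) simp
  qed
qed simp

section \<open>Avoiding residue classes modulo powers of two\<close>

lemma avoid_residues_interval:
  fixes a :: "nat \<Rightarrow> nat"
  shows "\<exists>x. \<forall>j. 1 \<le> j \<longrightarrow> j \<le> N \<longrightarrow> x mod 2 ^ j \<noteq> a j"
proof (induction N)
  case (Suc N)
  then obtain x where x: "\<And>j. 1 \<le> j \<Longrightarrow> j \<le> N \<Longrightarrow> x mod 2 ^ j \<noteq> a j" by blast
  \<comment> \<open>Adding \<open>2 ^ N\<close> keeps the residues already handled and changes the
    one modulo \<open>2 ^ Suc N\<close>, so \<open>x\<close> or \<open>x + 2 ^ N\<close> avoids the
    next class.\<close>
  have low: "(x + 2 ^ N) mod 2 ^ j = x mod 2 ^ j" if "j \<le> N" for j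
  proof -
    have "(2::nat) ^ j dvd 2 ^ N" using that by (simp add: le_imp_power_dvd)
    then show ?thesis by (metis mod_add_right_eq mod_0_imp_dvd dvd_imp_mod_0 add.right_neutral)
  qed
  have "(x + 2 ^ N) mod 2 ^ Suc N \<noteq> x mod 2 ^ Suc N"
  proof
    assume "(x + 2 ^ N) mod 2 ^ Suc N = x mod 2 ^ Suc N"
    then have "2 ^ Suc N dvd (x + 2 ^ N) - x" by (metis mod_eq_dvd_iff_nat le_add1)
    then have "(2::nat) ^ Suc N dvd 2 ^ N" by simp
    then show False by (simp add: nat_dvd_not_less)
  qed
  then consider "x mod 2 ^ Suc N \<noteq> a (Suc N)" | "(x + 2 ^ N) mod 2 ^ Suc N \<noteq> a (Suc N)"
    by fastforce
  then show ?case
  proof cases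
    case 1
    then show ?thesis using x by (metis le_Suc_eq)
  next
    case 2
    then show ?thesis using x low by (metis le_Suc_eq)
  qed
qed simp

text \<open>Injectivity of \<open>e\<close> leaves at most one forbidden class per modulus. The
  Thue-Morse parity is adjusted afterwards by a bit above all moduli, which no residue sees.\<close>

lemma avoid_residues:
  fixes a e :: "'i \<Rightarrow> nat"
  assumes "finite I" "inj_on e I" "\<And>i. i \<in> I \<Longrightarrow> 0 < e i"
  shows "\<exists>x. (x \<in> thue_morse \<longleftrightarrow> \<sigma>) \<and> (\<forall>i\<in>I. x mod 2 ^ e i \<noteq> a i)"
proof -
  define N where "N = Max (insert 0 (e ` I))"
  have N: "e i \<le> N" if "i \<in> I" for i
    using assms(1) that by (simp add: N_def)
  obtain x where x: "\<And>j. 1 \<le> j \<Longrightarrow> j \<le> N \<Longrightarrow> x mod 2 ^ j \<noteq> a (inv_into I e j)"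
    using avoid_residues_interval[of N "\<lambda>j. a (inv_into I e j)"] by blast
  \<comment> \<open>Reduction modulo \<open>2 ^ N\<close> frees bit \<open>N\<close>, which then
    serves to switch the parity.\<close>
  define y where "y = x mod 2 ^ N"
  have avoid: "(2 ^ N * q + y) mod 2 ^ e i \<noteq> a i" if "i \<in> I" for i q
  proof -
    have dvd: "(2::nat) ^ e i dvd 2 ^ N" using N[OF that] by (simp add: le_imp_power_dvd)
    then have "(2 ^ N * q + y) mod 2 ^ e i = y mod 2 ^ e i"
      by (metis dvd_mult2 mod_add_left_eq dvd_imp_mod_0 add_0)
    also have "\<dots> = x mod 2 ^ e i" using dvd by (simp add: y_def mod_mod_cancel)
    also have "\<dots> \<noteq> a i"
      using x[of "e i"] N[OF that] assms(3)[OF that] inv_into_f_f[OF assms(2) that] by simp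
    finally show ?thesis .
  qed
  have "y < 2 ^ N" by (simp add: y_def)
  then have flip: "2 ^ N * Suc 0 + y \<in> thue_morse \<longleftrightarrow> y \<notin> thue_morse"
    by (subst thue_morse_append) auto
  show ?thesis
  proof (cases "y \<in> thue_morse \<longleftrightarrow> \<sigma>")
    case True
    then show ?thesis using avoid[of _ 0] by (intro exI[of _ y]) auto
  next
    case False
    then show ?thesis using avoid[of _ "Suc 0"] flip
      by (intro exI[of _ "2 ^ N * Suc 0 + y"]) blast
  qed
qed

section \<open>Words and values\<close>

lemma val_Nil [simp]: "val b [] = 0"
  by (simp add: val_def)

lemma val_snoc: "val b (w @ [c]) = val b w * b + c"
proof -
  have "val b (w @ [c]) = (\<Sum>j<Suc (length w). (c # rev w) ! j * b ^ j)"
    by (simp add: val_def)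
  also have "\<dots> = c + (\<Sum>j<length w. rev w ! j * b ^ Suc j)"
    by (subst sum.lessThan_Suc_shift) simp
  also have "\<dots> = val b w * b + c"
    by (simp add: val_def sum_distrib_left mult_ac)
  finally show ?thesis .
qed

lemma val_append: "val b (w @ u) = val b w * b ^ length u + val b u"
proof (induction u rule: rev_induct)
  case (snoc c u)
  have "val b (w @ u @ [c]) = val b (w @ u) * b + c"
    using val_snoc[of b "w @ u" c] by simp
  then show ?case using snoc by (simp add: val_snoc algebra_simps)
qed simp

lemma val_less:
  assumes "w \<in> lists (digits b)" shows "val b w < b ^ length w"
  using assms
proof (induction w rule: rev_induct)
  case (snoc c w)
  then have "val b w + 1 \<le> b ^ length w" "c < b" by (auto simp: digits_def)
  then have "(val b w + 1) * b \<le> b ^ length w * b" by (intro mult_right_mono) auto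
  with \<open>c < b\<close> show ?case by (simp add: val_snoc algebra_simps)
qed simp

lemma ex_word:
  assumes "v < b ^ l"
  shows "\<exists>w \<in> lists (digits b). length w = l \<and> val b w = v"
  using assms
proof (induction l arbitrary: v)
  case (Suc l)
  then have b: "b > 0" by (cases b) auto
  have "v div b < b ^ l" using Suc.prems by (simp add: less_mult_imp_div_less mult.commute)
  then obtain w where "w \<in> lists (digits b)" "length w = l" "val b w = v div b"
    using Suc.IH by blast
  then show ?case
    using b by (intro bexI[of _ "w @ [v mod b]"]) (auto simp: val_snoc digits_def)
qed simp

text \<open>Words of length \<open>l\<close> realise exactly the values below \<open>b ^ l\<close>,
  and every number is the value of a word. Left quotients thus correspond to classes of
  indistinguishable numbers, for which \<open>f\<close> is a complete invariant.\<close>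

lemma state_complexity_eq_card_range:
  fixes f :: "nat \<Rightarrow> 'c"
  assumes "b \<ge> 2"
    and f: "\<And>n n'. f n = f n' \<longleftrightarrow>
      (\<forall>l v. v < b ^ l \<longrightarrow> (n * b ^ l + v \<in> X \<longleftrightarrow> n' * b ^ l + v \<in> X))"
  shows "state_complexity b X = card (range f)"
proof -
  let ?Q = "\<lambda>n. {u \<in> lists (digits b). n * b ^ length u + val b u \<in> X}"
  have lq: "left_quotient (digits b) w (val_inv b X) = ?Q (val b w)"
    if "w \<in> lists (digits b)" for w
    using that by (auto simp: left_quotient_def val_inv_def val_append)
  have surj: "\<exists>w \<in> lists (digits b). val b w = n" for n
  proof -
    have "n < 2 ^ n" by (rule less_exp)
    also have "\<dots> \<le> b ^ n" using assms(1) by (rule power_mono) simp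
    finally show ?thesis using ex_word by blast
  qed
  have "{left_quotient (digits b) w (val_inv b X) | w. w \<in> lists (digits b)} = range ?Q"
    (is "?A = _")
  proof (intro equalityI subsetI)
    fix x assume "x \<in> ?A"
    then show "x \<in> range ?Q" using lq by blast
  next
    fix x assume "x \<in> range ?Q"
    then obtain n where "x = ?Q n" by blast
    moreover obtain w where "w \<in> lists (digits b)" "val b w = n" using surj by blast
    ultimately show "x \<in> ?A" using lq by blast
  qed
  moreover have Q: "?Q n = ?Q n' \<longleftrightarrow> f n = f n'" for n n'
  proof
    assume eq: "?Q n = ?Q n'"
    have "n * b ^ l + v \<in> X \<longleftrightarrow> n' * b ^ l + v \<in> X" if v: "v < b ^ l" for l v
    proof -
      obtain u where "u \<in> lists (digits b)" "length u = l" "val b u = v"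
        using ex_word[OF v] by blast
      with eq show ?thesis by blast
    qed
    then show "f n = f n'" using f by blast
  next
    assume "f n = f n'"
    then show "?Q n = ?Q n'" using f val_less by blast
  qed
  have "bij_betw (f \<circ> inv ?Q) (range ?Q) (range f)"
  proof -
    have h: "f (inv ?Q (?Q n)) = f n" for n
      using Q f_inv_into_f[of "?Q n" ?Q UNIV] by blast
    have "inj_on (f \<circ> inv ?Q) (range ?Q)"
    proof (rule inj_onI)
      fix x y assume "x \<in> range ?Q" "y \<in> range ?Q" and e: "(f \<circ> inv ?Q) x = (f \<circ> inv ?Q) y"
      then obtain n n' where xy: "x = ?Q n" "y = ?Q n'" by blast
      have "f n = f n'" using e unfolding xy comp_apply h .
      then show "x = y" using Q xy by blast
    qed
    moreover have "(f \<circ> inv ?Q) ` range ?Q = range f"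
      unfolding image_image comp_apply h ..
    ultimately show ?thesis by (simp add: bij_betw_def)
  qed
  ultimately show ?thesis
    by (simp add: state_complexity_def lang_state_complexity_def bij_betw_same_card)
qed

section \<open>Acceptance of words\<close>

locale scaled_thue_morse =
  fixes m p r k z :: nat
  assumes p_pos: "p > 0" and r_less: "r < m" and m_eq: "m = k * 2 ^ z" and odd_k: "odd k"
begin

definition cls :: "nat \<Rightarrow> nat \<times> bool" where
  "cls n = (n mod k, n div k \<in> thue_morse)"

definition md :: "nat \<Rightarrow> nat" where
  "md l = k * 2 ^ (z - p * l)"

definition rs :: "nat \<Rightarrow> nat" where
  "rs l = r div (2 ^ p) ^ l"

text \<open>In this form, containment in one class and nesting are immediate. For
  \<open>p * l < z\<close>, \<open>mem_S_iff\<close> identifies the set with the copy of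
  \<open>thue_morse\<close> scaled by \<open>md l\<close> and shifted by
  \<open>rs l\<close>.\<close>

definition S :: "nat \<Rightarrow> nat set" where
  "S l = {n. n mod md l = rs l \<and> cls n = cls (rs l)}"

definition X :: "nat set" where
  "X = {m * t + r | t. t \<in> thue_morse}"

definition label :: "nat \<Rightarrow> (nat \<times> bool) + nat" where
  "label n = (if \<exists>l. p * l < z \<and> n \<in> S l then Inr (LEAST l. p * l < z \<and> n \<in> S l)
     else Inl (cls n))"

lemma k_pos: "k > 0"
  using odd_k by (cases k) auto

lemma md_pos: "md l > 0"
  using k_pos by (simp add: md_def)

lemma md_mult: "p * l \<le> z \<Longrightarrow> md l * (2 ^ p) ^ l = m"
  by (simp add: md_def m_eq flip: power_mult power_add)

lemma rs_less: "p * l \<le> z \<Longrightarrow> rs l < md l"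
  using r_less md_mult[of l] by (simp add: rs_def less_mult_imp_div_less)

lemma md_dvd: assumes "l \<le> l'" "p * l' \<le> z" shows "md l = md l' * 2 ^ (p * (l' - l))"
proof -
  have "z - p * l = (z - p * l') + p * (l' - l)"
    using assms mult_le_mono2[OF assms(1), of p] by (simp add: diff_mult_distrib2)
  then show ?thesis by (simp add: md_def power_add)
qed

text \<open>Since \<open>m * D = k * B\<close>, replacing \<open>n\<close> by \<open>n mod k\<close>
  lowers the multiplier of \<open>m\<close> by \<open>D * (n div k)\<close>. What remains of it is
  below the power of two \<open>D\<close>, so \<open>thue_morse_append\<close> applies.\<close>

lemma mem_X_long_iff:
  assumes l: "z \<le> p * l" and v: "v < (2 ^ p) ^ l"
  shows "n * (2 ^ p) ^ l + v \<in> X \<longleftrightarrow>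
    (\<exists>t. (n mod k) * (2 ^ p) ^ l + v = m * t + r \<and> (n div k \<in> thue_morse \<longleftrightarrow> t \<in> thue_morse))"
proof -
  define D :: nat where "D = 2 ^ (p * l - z)"
  define B :: nat where "B = (2 ^ p) ^ l"
  define q where "q = n div k"
  define i where "i = n mod k"
  have mD: "m * D = k * B"
    using l by (simp add: m_eq D_def B_def flip: power_mult power_add)
  have n: "n * B + v = m * (D * q) + (i * B + v)"
  proof -
    have "n = k * q + i" by (simp add: q_def i_def)
    then have "n * B + v = (k * B) * q + (i * B + v)" by (simp add: algebra_simps)
    then show ?thesis by (simp flip: mD add: mult.assoc)
  qed
  have small: "t < D" if "i * B + v = m * t + r" for t
  proof -
    have "i + 1 \<le> k" using k_pos by (simp add: i_def Suc_leI)
    then have "(i + 1) * B \<le> k * B" by (rule mult_right_mono) simp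
    then have "i * B + v < m * D" using v by (simp add: mD B_def)
    then have "m * t < m * D" using that by linarith
    then show ?thesis by simp
  qed
  have app: "D * q + t \<in> thue_morse \<longleftrightarrow> (q \<in> thue_morse \<longleftrightarrow> t \<in> thue_morse)" if "t < D" for t
    using thue_morse_append that by (simp add: D_def)
  have "n * B + v \<in> X \<longleftrightarrow>
    (\<exists>t. i * B + v = m * t + r \<and> (q \<in> thue_morse \<longleftrightarrow> t \<in> thue_morse))"
  proof
    assume "n * B + v \<in> X"
    then obtain t where t: "t \<in> thue_morse" "n * B + v = m * t + r" by (auto simp: X_def)
    \<comment> \<open>As \<open>r < m\<close>, the multiplier \<open>t\<close> is the quotient by
      \<open>m\<close>, hence at least \<open>D * q\<close>.\<close>
    have "m * (D * q) < m * (t + 1)" using t(2) n r_less by simp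
    then have "D * q \<le> t" by (metis mult_less_cancel1 Suc_eq_plus1 less_Suc_eq_le)
    then obtain t0 where t0: "t = D * q + t0" by (metis le_add_diff_inverse)
    have "i * B + v = m * t0 + r" using t(2) n t0 by (simp add: algebra_simps)
    with small app t(1) t0 show "\<exists>t. i * B + v = m * t + r \<and> (q \<in> thue_morse \<longleftrightarrow> t \<in> thue_morse)"
      by blast
  next
    assume "\<exists>t. i * B + v = m * t + r \<and> (q \<in> thue_morse \<longleftrightarrow> t \<in> thue_morse)"
    then obtain t where t: "i * B + v = m * t + r" "q \<in> thue_morse \<longleftrightarrow> t \<in> thue_morse" by blast
    then have "D * q + t \<in> thue_morse" using small app by blast
    moreover have "n * B + v = m * (D * q + t) + r" using n t(1) by (simp add: algebra_simps)
    ultimately show "n * B + v \<in> X" by (auto simp: X_def)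
  qed
  then show ?thesis by (simp add: B_def i_def q_def)
qed

text \<open>Adding \<open>md l * t\<close> keeps the residue modulo \<open>k\<close> and puts the
  digits of \<open>t\<close> in front of the \<open>z - p * l\<close> low digits of the quotient by
  \<open>k\<close>.\<close>

lemma cls_eq_rs_iff:
  assumes l: "p * l < z"
  shows "cls (md l * t + rs l) = cls (rs l) \<longleftrightarrow> t \<in> thue_morse"
proof -
  have md: "md l * t + rs l = rs l + k * (2 ^ (z - p * l) * t)" by (simp add: md_def)
  have "(md l * t + rs l) mod k = rs l mod k" unfolding md by simp
  moreover have "(md l * t + rs l) div k = 2 ^ (z - p * l) * t + rs l div k"
    unfolding md using k_pos by simp
  moreover have "rs l div k < 2 ^ (z - p * l)"
    using rs_less[of l] l by (simp add: md_def less_mult_imp_div_less mult.commute)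
  ultimately show ?thesis by (auto simp: cls_def thue_morse_append)
qed

lemma mem_S_iff:
  assumes l: "p * l < z"
  shows "n \<in> S l \<longleftrightarrow> (\<exists>t \<in> thue_morse. n = md l * t + rs l)"
proof
  assume n: "n \<in> S l"
  have "n = md l * (n div md l) + n mod md l" by simp
  also have "n mod md l = rs l" using n by (simp add: S_def)
  finally show "\<exists>t \<in> thue_morse. n = md l * t + rs l"
    using n cls_eq_rs_iff[OF l] by (metis (mono_tags, lifting) S_def mem_Collect_eq)
next
  assume "\<exists>t \<in> thue_morse. n = md l * t + rs l"
  then show "n \<in> S l" using cls_eq_rs_iff[OF l] rs_less[of l] l by (auto simp: S_def)
qed

text \<open>Here \<open>(2 ^ p) ^ l\<close> divides \<open>m\<close>; comparing remainders fixes the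
  word, comparing quotients gives the condition on \<open>n\<close>.\<close>

lemma mem_X_short_iff:
  assumes l: "p * l < z" and v: "v < (2 ^ p) ^ l"
  shows "n * (2 ^ p) ^ l + v \<in> X \<longleftrightarrow> v = r mod (2 ^ p) ^ l \<and> n \<in> S l"
proof -
  define B :: nat where "B = (2 ^ p) ^ l"
  have B: "B > 0" by (simp add: B_def)
  have m: "m = md l * B" using md_mult[of l] l by (simp add: B_def)
  have "n * B + v = m * t + r \<longleftrightarrow> v = r mod B \<and> n = md l * t + rs l" for t
  proof -
    have e: "m * t + r = r mod B + (md l * t + rs l) * B"
      using div_mult_mod_eq[of r B] unfolding rs_def B_def[symmetric] m by (simp add: algebra_simps)
    show ?thesis
    proof
      assume a: "n * B + v = m * t + r"
      have "(n * B + v) mod B = v" "(n * B + v) div B = n" using v B by (simp_all add: B_def)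
      moreover have "(m * t + r) mod B = r mod B" "(m * t + r) div B = md l * t + rs l"
        unfolding e using B by simp_all
      ultimately show "v = r mod B \<and> n = md l * t + rs l" using a by simp
    next
      assume "v = r mod B \<and> n = md l * t + rs l"
      then show "n * B + v = m * t + r" unfolding e by simp
    qed
  qed
  then show ?thesis unfolding X_def mem_S_iff[OF l] B_def by blast
qed

text \<open>One of any \<open>2 * j\<close>, \<open>Suc (2 * j)\<close> is in
  \<open>thue_morse\<close>, so the gaps of \<open>X\<close> are bounded and a long enough word
  reaches the next element.\<close>

lemma ex_long_accepted:
  obtains l v where "z \<le> p * l" "v < (2 ^ p) ^ l" "n * (2 ^ p) ^ l + v \<in> X"
proof -
  define l where "l = 4 * m"
  define N where "N = n * (2 ^ p) ^ l"
  have m: "m > 0" using r_less by simp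
  have "z < 2 ^ z" by (rule less_exp)
  also have "(2::nat) ^ z \<le> m" using k_pos by (simp add: m_eq)
  finally have "z \<le> 1 * l" by (simp add: l_def)
  also have "1 * l \<le> p * l" using p_pos by (intro mult_right_mono) auto
  finally have z: "z \<le> p * l" .
  have "l < 2 ^ l" by (rule less_exp)
  also have "(2::nat) ^ l \<le> (2 ^ p) ^ l"
    using p_pos by (intro power_mono) (auto simp: self_le_power)
  finally have l: "4 * m < (2 ^ p) ^ l" by (simp add: l_def)
  \<comment> \<open>\<open>2 * m * j\<close> is the least multiple of \<open>2 * m\<close> above
    \<open>N\<close>. Passing to \<open>t\<close> adds at most \<open>m\<close> and \<open>r\<close>
    adds less than \<open>m\<close>, so the distance from \<open>N\<close> stays below
    \<open>4 * m\<close>.\<close>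
  define j where "j = N div (2 * m) + 1"
  obtain t where t: "t \<in> thue_morse" "t = 2 * j \<or> t = Suc (2 * j)"
    using double_in_thue_morse Suc_double_in_thue_morse by blast
  have mj: "m * (2 * j) = N div (2 * m) * (2 * m) + 2 * m" by (simp add: j_def algebra_simps)
  have "N mod (2 * m) < 2 * m" using m by simp
  then have "N < m * (2 * j)" "m * (2 * j) \<le> N + 2 * m"
    using div_mult_mod_eq[of N "2 * m"] mj by linarith+
  moreover have "m * (2 * j) \<le> m * t" "m * t \<le> m * (2 * j) + m" using t(2) by auto
  ultimately have "N \<le> m * t + r" "m * t + r - N < (2 ^ p) ^ l" using r_less l by linarith+
  moreover have "N + (m * t + r - N) \<in> X" using \<open>N \<le> m * t + r\<close> t(1) by (auto simp: X_def)
  ultimately show ?thesis using that z unfolding N_def by blast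
qed

section \<open>Counting the states\<close>

lemma indistinguishable_iff:
  "(\<forall>l v. v < (2 ^ p) ^ l \<longrightarrow> (n * (2 ^ p) ^ l + v \<in> X \<longleftrightarrow> n' * (2 ^ p) ^ l + v \<in> X)) \<longleftrightarrow>
   cls n = cls n' \<and> (\<forall>l. p * l < z \<longrightarrow> (n \<in> S l \<longleftrightarrow> n' \<in> S l))"
  (is "?E \<longleftrightarrow> ?C")
proof
  assume E: ?E
  \<comment> \<open>Different classes accept no long word in common, so a single one accepted from
    \<open>n\<close> suffices.\<close>
  obtain l v where lv: "z \<le> p * l" "v < (2 ^ p) ^ l" "n * (2 ^ p) ^ l + v \<in> X"
    by (rule ex_long_accepted)
  define B :: nat where "B = (2 ^ p) ^ l"
  have "n' * (2 ^ p) ^ l + v \<in> X" using E lv by blast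
  then obtain t t' where
    t: "(n mod k) * B + v = m * t + r" "n div k \<in> thue_morse \<longleftrightarrow> t \<in> thue_morse" and
    t': "(n' mod k) * B + v = m * t' + r" "n' div k \<in> thue_morse \<longleftrightarrow> t' \<in> thue_morse"
    using lv unfolding mem_X_long_iff[OF lv(1,2)] B_def by blast
  \<comment> \<open>Subtracting the equations shows that \<open>k\<close> divides the difference of
    the residues times \<open>B\<close>; as \<open>k\<close> is odd and \<open>B\<close> a power of
    two, the residues agree.\<close>
  have "int (n mod k) * int B + int v = int m * int t + int r"
    "int (n' mod k) * int B + int v = int m * int t' + int r"
    using t(1) t'(1) by (metis of_nat_add of_nat_mult)+
  then have "(int (n mod k) - int (n' mod k)) * int B = int m * (int t - int t')"
    by (simp add: algebra_simps)
  also have "\<dots> = int k * (2 ^ z * (int t - int t'))"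
    by (simp add: m_eq)
  finally have "int k dvd (int (n mod k) - int (n' mod k)) * int B" by simp
  moreover have "coprime (int k) (int B)" using odd_k by (simp add: B_def)
  ultimately have "int k dvd int (n mod k) - int (n' mod k)"
    using coprime_dvd_mult_left_iff by blast
  then have "int (n mod k) mod int k = int (n' mod k) mod int k"
    by (simp add: mod_eq_dvd_iff)
  then have nk: "n mod k = n' mod k" by (simp flip: zmod_int)
  then have "t = t'" using t(1) t'(1) r_less by auto
  with nk t(2) t'(2) have "cls n = cls n'" by (simp add: cls_def)
  moreover have "n \<in> S l \<longleftrightarrow> n' \<in> S l" if "p * l < z" for l
  proof -
    \<comment> \<open>This is the value of the only candidate word of length \<open>l\<close>; it
      tests membership in \<open>S l\<close>.\<close>
    have "r mod (2 ^ p) ^ l < (2 ^ p) ^ l" by simp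
    then show ?thesis using E mem_X_short_iff[OF that] by blast
  qed
  ultimately show ?C by blast
next
  assume C: ?C
  show ?E
  proof (intro allI impI)
    fix l v :: nat assume v: "v < (2 ^ p) ^ l"
    show "n * (2 ^ p) ^ l + v \<in> X \<longleftrightarrow> n' * (2 ^ p) ^ l + v \<in> X"
    proof (cases "p * l < z")
      case True
      then show ?thesis using C v by (simp add: mem_X_short_iff)
    next
      case False
      then have "z \<le> p * l" by simp
      then show ?thesis using C v by (simp add: mem_X_long_iff cls_def)
    qed
  qed
qed

text \<open>Elements of \<open>S l\<close> agree modulo \<open>md l\<close>, hence modulo its
  divisor \<open>md l'\<close>, and share one class.\<close>

lemma S_nested:
  assumes "l < l'" "p * l' < z" "n \<in> S l" "n' \<in> S l" "n \<in> S l'"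
  shows "n' \<in> S l'"
proof -
  have "md l' dvd md l" using md_dvd[of l l'] assms by simp
  moreover have "n mod md l = n' mod md l" using assms(3,4) by (simp add: S_def)
  ultimately have "n mod md l' = n' mod md l'" by (metis mod_mod_cancel)
  then show ?thesis using assms(3-5) by (simp add: S_def)
qed

section \<open>Labels as a complete invariant of states\<close>

lemma label_InrD:
  assumes "label n = Inr l"
  shows "p * l < z" "n \<in> S l" "\<And>j. j < l \<Longrightarrow> p * j < z \<Longrightarrow> n \<notin> S j"
proof -
  have ex: "\<exists>l. p * l < z \<and> n \<in> S l" and l: "l = (LEAST l. p * l < z \<and> n \<in> S l)"
    using assms by (auto simp: label_def split: if_splits)
  show "p * l < z" "n \<in> S l" using LeastI_ex[OF ex] l by auto
  show "n \<notin> S j" if "j < l" "p * j < z" for j using not_less_Least that l by blast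
qed

lemma label_InlD:
  assumes "label n = Inl c"
  shows "cls n = c" "\<And>l. p * l < z \<Longrightarrow> n \<notin> S l"
  using assms by (auto simp: label_def split: if_splits)

lemma label_eq_iff:
  "label n = label n' \<longleftrightarrow> cls n = cls n' \<and> (\<forall>l. p * l < z \<longrightarrow> (n \<in> S l \<longleftrightarrow> n' \<in> S l))"
proof
  assume eq: "label n = label n'"
  show "cls n = cls n' \<and> (\<forall>l. p * l < z \<longrightarrow> (n \<in> S l \<longleftrightarrow> n' \<in> S l))"
  proof (cases "label n")
    case (Inl c)
    then show ?thesis using eq label_InlD[of n c] label_InlD[of n' c] by auto
  next
    case (Inr l)
    note n = label_InrD[OF Inr]
    have n': "n' \<in> S l" "\<And>j. j < l \<Longrightarrow> p * j < z \<Longrightarrow> n' \<notin> S j"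
      using label_InrD[of n' l] Inr eq by auto
    \<comment> \<open>Below \<open>l\<close> both memberships fail by minimality; above
      \<open>l\<close>, nesting transfers membership both ways.\<close>
    have "n \<in> S j \<longleftrightarrow> n' \<in> S j" if "p * j < z" for j
      using that n n' S_nested[of l j] by (metis linorder_neqE_nat)
    moreover have "cls n = cls n'" using n(2) n'(1) by (simp add: S_def)
    ultimately show ?thesis by blast
  qed
next
  assume a: "cls n = cls n' \<and> (\<forall>l. p * l < z \<longrightarrow> (n \<in> S l \<longleftrightarrow> n' \<in> S l))"
  then have "(\<lambda>l. p * l < z \<and> n \<in> S l) = (\<lambda>l. p * l < z \<and> n' \<in> S l)" by blast
  then show "label n = label n'" using a by (simp add: label_def)
qed

section \<open>Realising and counting the labels\<close>

lemma finite_short: "finite {l. p * l < z}"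
proof (rule finite_subset)
  show "{l. p * l < z} \<subseteq> {..z}"
  proof
    fix l assume "l \<in> {l. p * l < z}"
    moreover have "1 * l \<le> p * l" using p_pos by (intro mult_right_mono) auto
    ultimately show "l \<in> {..z}" unfolding mem_Collect_eq atMost_iff by linarith
  qed
qed simp

text \<open>For \<open>n = md l * t + rs l\<close>, membership in \<open>S j\<close> with
  \<open>j < l\<close> would prescribe \<open>t\<close> modulo \<open>2 ^ (p * (l - j))\<close>.
  These exponents are positive and distinct, so some \<open>t\<close> in \<open>thue_morse\<close>
  avoids all these classes.\<close>

lemma ex_label_Inr:
  assumes l: "p * l < z"
  shows "\<exists>n. label n = Inr l"
proof -
  have inj: "inj_on (\<lambda>j. p * (l - j)) {..<l}"
    using p_pos by (auto simp: inj_on_def)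
  obtain t where t: "t \<in> thue_morse"
    "\<And>j. j < l \<Longrightarrow> t mod 2 ^ (p * (l - j)) \<noteq> rs j div md l"
    using avoid_residues[OF _ inj, of True "\<lambda>j. rs j div md l"] p_pos by auto
  define n where "n = md l * t + rs l"
  have S: "n \<in> S l" using t(1) l by (auto simp: mem_S_iff n_def)
  have notS: "n \<notin> S j" if "j < l" for j
  proof
    assume "n \<in> S j"
    then have "rs j = n mod (md l * 2 ^ (p * (l - j)))"
      using md_dvd[of j l] that l by (simp add: S_def)
    also have "\<dots> = md l * (n div md l mod 2 ^ (p * (l - j))) + n mod md l"
      by (rule mod_mult2_eq)
    also have "n div md l = t" using rs_less[of l] l md_pos[of l] by (simp add: n_def)
    also have "n mod md l = rs l" using rs_less[of l] l by (simp add: n_def)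
    finally have "rs j div md l = t mod 2 ^ (p * (l - j))"
      using rs_less[of l] l md_pos[of l] by simp
    with t(2)[OF that] show False by simp
  qed
  have "(LEAST j. p * j < z \<and> n \<in> S j) = l"
    using S notS l by (intro Least_equality) (auto simp: not_less[symmetric])
  with S l have "label n = Inr l" by (auto simp: label_def)
  then show ?thesis ..
qed

text \<open>For \<open>n = k * q + i\<close>, membership in \<open>S l\<close> would prescribe
  \<open>q\<close> modulo \<open>2 ^ (z - p * l)\<close>; again the exponents are positive and
  distinct, and the parity of \<open>q\<close> stays free.\<close>

lemma ex_label_Inl:
  assumes i: "i < k"
  shows "\<exists>n. label n = Inl (i, \<sigma>)"
proof -
  have inj: "inj_on (\<lambda>l. z - p * l) {l. p * l < z}"
  proof (rule inj_onI)
    fix x y assume "x \<in> {l. p * l < z}" "y \<in> {l. p * l < z}" "z - p * x = z - p * y"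
    then have "p * x = p * y" unfolding mem_Collect_eq by linarith
    then show "x = y" using p_pos by simp
  qed
  obtain q where q: "q \<in> thue_morse \<longleftrightarrow> \<sigma>"
    "\<And>l. p * l < z \<Longrightarrow> q mod 2 ^ (z - p * l) \<noteq> rs l div k"
    using avoid_residues[OF finite_short inj, of \<sigma> "\<lambda>l. rs l div k"] by auto
  define n where "n = k * q + i"
  have n: "n div k = q" "n mod k = i" using i by (simp_all add: n_def)
  have "n \<notin> S l" if "p * l < z" for l
  proof
    assume "n \<in> S l"
    then have "rs l = n mod (k * 2 ^ (z - p * l))" by (simp add: S_def md_def)
    also have "\<dots> = k * (q mod 2 ^ (z - p * l)) + i" by (simp add: mod_mult2_eq n)
    finally have "rs l div k = q mod 2 ^ (z - p * l)" using i by simp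
    with q(2)[OF that] show False by simp
  qed
  then have "label n = Inl (i, \<sigma>)" using q(1) n by (auto simp: label_def cls_def)
  then show ?thesis ..
qed

lemma range_label: "range label = ({..<k} \<times> UNIV) <+> {l. p * l < z}"
proof (intro equalityI subsetI)
  fix x assume "x \<in> range label"
  then obtain n where n: "x = label n" by blast
  show "x \<in> ({..<k} \<times> UNIV) <+> {l. p * l < z}"
  proof (cases x)
    case (Inl c)
    then have "c = cls n" using label_InlD n by metis
    then show ?thesis using k_pos Inl by (auto simp: cls_def)
  next
    case (Inr l)
    then show ?thesis using label_InrD(1)[of n l] n by auto
  qed
next
  fix x assume "x \<in> ({..<k} \<times> (UNIV :: bool set)) <+> {l. p * l < z}"
  then show "x \<in> range label"
    using ex_label_Inl ex_label_Inr by (auto simp: image_iff) metis+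
qed

lemma card_short: "int (card {l. p * l < z}) = \<lceil>real z / real p\<rceil>"
proof -
  \<comment> \<open>Lengths start at 0 and satisfy a strict inequality, so their number is the
    ceiling, also when \<open>p\<close> divides \<open>z\<close>.\<close>
  have "{l. p * l < z} = {..<nat \<lceil>real z / real p\<rceil>}"
  proof (rule set_eqI)
    fix l
    have "p * l < z \<longleftrightarrow> real (p * l) < real z" by (rule of_nat_less_iff[symmetric])
    also have "\<dots> \<longleftrightarrow> real l < real z / real p" using p_pos by (simp add: field_simps)
    also have "\<dots> \<longleftrightarrow> l < nat \<lceil>real z / real p\<rceil>"
      using less_ceiling_iff[of "int l" "real z / real p"] by (simp add: zless_nat_eq_int_zless)
    finally show "l \<in> {l. p * l < z} \<longleftrightarrow> l \<in> {..<nat \<lceil>real z / real p\<rceil>}" by simp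
  qed
  moreover have "\<lceil>real z / real p\<rceil> \<ge> 0"
    by (rule order_trans[OF _ ceiling_mono[of 0]]) simp_all
  ultimately show ?thesis by simp
qed

lemma state_complexity_X: "int (state_complexity (2 ^ p) X) = 2 * int k + \<lceil>real z / real p\<rceil>"
proof -
  have "state_complexity (2 ^ p) X = card (range label)"
    using p_pos by (intro state_complexity_eq_card_range)
      (auto simp: indistinguishable_iff label_eq_iff self_le_power)
  also have "\<dots> = 2 * k + card {l. p * l < z}"
    unfolding range_label by (subst card_Plus) (simp_all add: finite_short card_cartesian_product)
  finally show ?thesis using card_short by simp
qed

end

theorem theorem3:
  fixes m p r k z :: nat
  assumes "m > 0" and "p > 0" and "r < m"
    and "m = k * 2 ^ z" and "odd k"
  shows "int (state_complexity (2 ^ p) {m * t + r | t. t \<in> thue_morse})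
           = 2 * int k + \<lceil>real z / real p\<rceil>"
proof -
  interpret scaled_thue_morse m p r k z
    using assms by unfold_locales
  show ?thesis using state_complexity_X unfolding X_def .
qed

end
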